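(* Assume that $\mathcal B$ and $\mathcal B_N$ are $\alpha$-contractions on the same Banach space of bounded functions (on $\mathcal I$), and let $V^*$ and $V_N^*$ be their respective fixed points. If $$\sup_{I\in\mathcal R}|(\mathcal B_NV^* )(I)-(\mathcal BV^* )(I)|\le\varepsilon_N^{\mathcal B},$$ then $$\sup_{I\in\mathcal R}|V_N^*(I)-V^*(I)|\le\frac{\varepsilon_N^{\mathcal B}}{1-\alpha}.$$ More specifically, if $$\varepsilon_N^{\mathcal K}(V^* ):=\sup_{I\in\mathcal R,\,u\in\mathcal U}\Bigl|\int_{\mathcal I}V^*(I')\,\mathcal K_N(dI'\mid I,u)-\int_{\mathcal I}V^*(I')\,\mathcal K(dI'\mid I,u)\Bigr|,\qquad \varepsilon_N^g:=\sup_{I\in\mathcal R,\,u\in\mathcal U}|g_N(I,u)-g(I,u)|,$$ then (with $\varepsilon_N^{\mathcal B}$ taken to be the supremum on the left-hand side of the first display) $$\varepsilon_N^{\mathcal B}\le\varepsilon_N^g+\alpha\,\varepsilon_N^{\mathcal K}(V^* ),$$ and therefore $$\sup_{I\in\mathcal R}|V_N^*(I)-V^*(I)|\le\frac{\varepsilon_N^g+\alpha\,\varepsilon_N^{\mathcal K}(V^* )}{1-\alpha}.$$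
   Context: Model. $\mathcal X$ (states), $\mathcal U$ (actions), $\mathsf E$, $\mathsf V$ (noises) are standard Borel spaces, $G:\mathcal X\times\mathcal U\times\mathsf E\times\mathsf V\to\mathcal X$ is Borel, $\nu_\eta,\nu_\varepsilon$ are probability measures on $\mathsf E,\mathsf V$, and $Q(C\mid x,u)=\int_{\mathsf E}\int_{\mathsf V}\mathbf 1_C(G(x,u,e,v))\,\nu_\varepsilon(dv)\,\nu_\eta(de)$. $\mathcal P(\mathcal X)$ is the set of probability measures on $\mathcal X$. The observable classes $O_1,\dots,O_{r+1}$ are pairwise disjoint measurable sets with union $\mathcal X$; $\mathsf J=\{j:O_j\neq\varnothing\}$. $(\mathcal L_u\mu)(C)=\int Q(C\mid x,u)\,\mu(dx)$; $p_k(\mu,u)=(\mathcal L_u\mu)(O_k)$; $\Phi_k(\mu,u)(C)=(\mathcal L_u\mu)(C\cap O_k)/p_k(\mu,u)$ if $p_k(\mu,u)>0$, and $\Phi_k(\mu,u)=\rho_k$ otherwise, with $\rho_k$ a fixed probability measure, $\rho_k(O_k)=1$. Information-state model. $\mathcal P_j=\{\mu\in\mathcal P(\mathcal X):\mu(O_j)=1\}$, $\mathcal I=\bigcup_{j\in\mathsf J}(\{j\}\times\mathcal P_j)$ with the trace $\sigma$-field of $\mathsf J\times\mathcal P(\mathcal X)$ (evaluation $\sigma$-field on $\mathcal P(\mathcal X)$). For $I=(j,\mu)$: $\mathcal K(D\mid I,u)=\sum_{k\in\mathsf J}p_k(\mu,u)\mathbf 1_D\bigl((k,\Phi_k(\mu,u))\bigr)$,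 $g(I,u)=\int c(x,u)\,\mu(dx)$ with $c:\mathcal X\times\mathcal U\to\mathbb R$ bounded Borel. $\alpha\in(0,1)$. $(\mathcal Bv)(I)=\inf_{u\in\mathcal U}\{g(I,u)+\alpha\int v\,d\mathcal K(\cdot\mid I,u)\}$. $B_b(\mathcal I)$ denotes the bounded Borel functions on $\mathcal I$ with the supremum norm. Approximation. $\mathcal R=\bigcup_{j\in\mathsf J}(\{j\}\times\mathcal R_j)$, where $\mathcal R_j\subseteq\mathcal P_j$ is the set of class-$j$ conditional measures reachable from the prescribed initial distribution under admissible controls and positive-probability observation histories. For $N\in\mathbb N$ and $k\in\mathsf J$, $\mathcal Z_{N,k}\subseteq\mathcal P_k$ is a finite-dimensional family and $\Pi_{N,k}$ is a measurable probability-preserving projection onto $\mathcal Z_{N,k}$ (defined on the measures to which it is applied below). $\Phi_{N,k}(\mu,u)=\Pi_{N,k}(\Phi_k(\mu,u))$ if $p_k(\mu,u)>0$ and $\Phi_{N,k}(\mu,u)=\Pi_{N,k}\rho_k$ otherwise. $\mathcal K_N(D\mid I,u)=\sum_{k\in\mathsf J}p_k(\mu,u)\mathbf 1_D\bigl((k,\Phi_{N,k}(\mu,u))\bigr)$ for $I=(j,\mu)$. $g_N:\mathcal I\times\mathcal U\to\mathbb R$ is an approximate filtered cost, and $(\mathcal B_Nv)(I)=\inf_{u\in\mathcal U}\{g_N(I,u)+\alpha\int v\,d\mathcal K_N(\cdot\mid I,u)\}$.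
   Formalization: Both bounds on sup over R of |V_N* − V*| are proved under the added assumption that B_N is an α-contraction also for the supremum over R; without it they fail, since projections may leave R. The bound on ε_N^B needs no addition. *)

theory Defs
  imports "HOL-Probability.Probability"
begin

definition standard_borel :: "'a measure \<Rightarrow> bool" where
  "standard_borel S \<longleftrightarrow>
     (\<exists>T. completely_metrizable_space T \<and>
          (\<exists>C. countable C \<and> C \<subseteq> topspace T \<and> T closure_of C = topspace T) \<and>
          space S = topspace T \<and> sets S = sigma_sets (topspace T) {W. openin T W})"

text \<open>
  Of the measures \<open>states\<close> and \<open>actions\<close> only the underlying measurable space is used.
  The noise measures carry the measurable structure of the noise spaces.  The observable
  classes are \<open>obs 1, \<dots>, obs (rr + 1)\<close>.
\<close>

record ('x, 'u, 'e, 'v) obs_model =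
  states :: "'x measure"
  actions :: "'u measure"
  noise_eta :: "'e measure"
  noise_eps :: "'v measure"
  dyn :: "'x \<times> 'u \<times> 'e \<times> 'v \<Rightarrow> 'x"
  rr :: nat
  obs :: "nat \<Rightarrow> 'x set"
  rho :: "nat \<Rightarrow> 'x measure"
  cost :: "'x \<times> 'u \<Rightarrow> real"
  discount :: real
  init :: "'x measure"

type_synonym 'x info = "nat \<times> 'x measure"

text \<open>
  \<open>emeasure_pair_measure\<close> unfolds \<open>Q(C | x, u)\<close> below to the iterated integral of
  \<open>indicator C (dyn (x, u, e, v))\<close>, first over \<open>v\<close> and then over \<open>e\<close>.
\<close>

definition trans_kernel :: "('x, 'u, 'e, 'v) obs_model \<Rightarrow> 'x \<Rightarrow> 'u \<Rightarrow> 'x measure" where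
  "trans_kernel M x u =
     distr (noise_eta M \<Otimes>\<^sub>M noise_eps M) (states M) (\<lambda>(e, v). dyn M (x, u, e, v))"

definition prediction :: "('x, 'u, 'e, 'v) obs_model \<Rightarrow> 'u \<Rightarrow> 'x measure \<Rightarrow> 'x measure" where
  "prediction M u \<mu> = \<mu> \<bind> (\<lambda>x. trans_kernel M x u)"

definition obs_prob :: "('x, 'u, 'e, 'v) obs_model \<Rightarrow> nat \<Rightarrow> 'x measure \<Rightarrow> 'u \<Rightarrow> real" where
  "obs_prob M k \<mu> u = measure (prediction M u \<mu>) (obs M k)"

definition filter_update ::
  "('x, 'u, 'e, 'v) obs_model \<Rightarrow> nat \<Rightarrow> 'x measure \<Rightarrow> 'u \<Rightarrow> 'x measure" where
  "filter_update M k \<mu> u =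
     (if obs_prob M k \<mu> u > 0 then uniform_measure (prediction M u \<mu>) (obs M k) else rho M k)"

definition classes :: "('x, 'u, 'e, 'v) obs_model \<Rightarrow> nat set" where
  "classes M = {j \<in> {1..rr M + 1}. obs M j \<noteq> {}}"

definition class_measures :: "('x, 'u, 'e, 'v) obs_model \<Rightarrow> nat \<Rightarrow> 'x measure set" where
  "class_measures M j = {\<mu> \<in> space (prob_algebra (states M)). measure \<mu> (obs M j) = 1}"

definition info_states :: "('x, 'u, 'e, 'v) obs_model \<Rightarrow> 'x info set" where
  "info_states M = Sigma (classes M) (class_measures M)"

definition info_space :: "('x, 'u, 'e, 'v) obs_model \<Rightarrow> 'x info measure" where
  "info_space M =
     restrict_space (count_space (classes M) \<Otimes>\<^sub>M prob_algebra (states M)) (info_states M)"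

locale observation_model =
  fixes M :: "('x, 'u, 'e, 'v) obs_model"
  assumes states_borel: "standard_borel (states M)"
    and actions_borel: "standard_borel (actions M)"
    and noise_eta_borel: "standard_borel (noise_eta M)"
    and noise_eps_borel: "standard_borel (noise_eps M)"
    and actions_nonempty: "space (actions M) \<noteq> {}"
    and noise_eta_prob: "prob_space (noise_eta M)"
    and noise_eps_prob: "prob_space (noise_eps M)"
    and dyn_measurable:
      "dyn M \<in> states M \<Otimes>\<^sub>M actions M \<Otimes>\<^sub>M noise_eta M \<Otimes>\<^sub>M noise_eps M \<rightarrow>\<^sub>M states M"
    and obs_sets: "\<And>j. j \<in> {1..rr M + 1} \<Longrightarrow> obs M j \<in> sets (states M)"
    and obs_disjoint: "disjoint_family_on (obs M) {1..rr M + 1}"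
    and obs_cover: "(\<Union>j\<in>{1..rr M + 1}. obs M j) = space (states M)"
    and rho_class: "\<And>k. k \<in> classes M \<Longrightarrow> rho M k \<in> class_measures M k"
    and cost_measurable: "cost M \<in> borel_measurable (states M \<Otimes>\<^sub>M actions M)"
    and cost_bounded: "bounded (cost M ` (space (states M) \<times> space (actions M)))"
    and discount_pos: "0 < discount M"
    and discount_less_1: "discount M < 1"
    and init_prob: "init M \<in> space (prob_algebra (states M))"

text \<open>
  The kernel on information states that puts mass \<open>p\<^sub>k(\<mu>, u)\<close> on \<open>(k, \<phi> k \<mu> u)\<close>; the exact and
  the approximate model differ only in the posterior map \<open>\<phi>\<close>.
\<close>

definition posterior_kernel ::
  "('x, 'u, 'e, 'v) obs_model \<Rightarrow> (nat \<Rightarrow> 'x measure \<Rightarrow> 'u \<Rightarrow> 'x measure) \<Rightarrow>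
   'x info \<Rightarrow> 'u \<Rightarrow> 'x info measure" where
  "posterior_kernel M \<phi> I u =
     measure_of (space (info_space M)) (sets (info_space M))
       (\<lambda>D. \<Sum>k\<in>classes M. ennreal (obs_prob M k (snd I) u) * indicator D (k, \<phi> k (snd I) u))"

definition info_kernel ::
  "('x, 'u, 'e, 'v) obs_model \<Rightarrow> 'x info \<Rightarrow> 'u \<Rightarrow> 'x info measure" where
  "info_kernel M = posterior_kernel M (filter_update M)"

definition info_cost :: "('x, 'u, 'e, 'v) obs_model \<Rightarrow> 'x info \<Rightarrow> 'u \<Rightarrow> real" where
  "info_cost M I u = (\<integral>x. cost M (x, u) \<partial>snd I)"

text \<open>
  The infimum is taken in the reals, so it has its intended meaning only where the set of
  values is nonempty and bounded below.
\<close>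

definition bellman ::
  "('x, 'u, 'e, 'v) obs_model \<Rightarrow> ('x info \<Rightarrow> 'u \<Rightarrow> real) \<Rightarrow> ('x info \<Rightarrow> 'u \<Rightarrow> 'x info measure) \<Rightarrow>
   ('x info \<Rightarrow> real) \<Rightarrow> 'x info \<Rightarrow> real" where
  "bellman M h \<kappa> v I = (INF u\<in>space (actions M). h I u + discount M * (\<integral>I'. v I' \<partial>\<kappa> I u))"

definition bellman_exact ::
  "('x, 'u, 'e, 'v) obs_model \<Rightarrow> ('x info \<Rightarrow> real) \<Rightarrow> 'x info \<Rightarrow> real" where
  "bellman_exact M = bellman M (info_cost M) (info_kernel M)"

text \<open>
  The initial distribution need not be concentrated on one class: the time-zero information
  state is obtained by conditioning it on the class observed at time zero.
\<close>

inductive_set reachable :: "('x, 'u, 'e, 'v) obs_model \<Rightarrow> 'x info set"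
  for M :: "('x, 'u, 'e, 'v) obs_model" where
  start: "k \<in> classes M \<Longrightarrow> measure (init M) (obs M k) > 0 \<Longrightarrow>
    (k, uniform_measure (init M) (obs M k)) \<in> reachable M"
| step: "(j, \<mu>) \<in> reachable M \<Longrightarrow> u \<in> space (actions M) \<Longrightarrow> k \<in> classes M \<Longrightarrow>
    obs_prob M k \<mu> u > 0 \<Longrightarrow> (k, filter_update M k \<mu> u) \<in> reachable M"

text \<open>
  \<open>family k\<close> is the set of measures onto which \<open>proj k\<close> projects; \<open>proj k\<close> is only
  meaningful on \<open>proj_dom k\<close>.
\<close>

record ('x, 'u) filter_approx =
  family :: "nat \<Rightarrow> 'x measure set"
  proj_dom :: "nat \<Rightarrow> 'x measure set"
  proj :: "nat \<Rightarrow> 'x measure \<Rightarrow> 'x measure"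
  approx_cost :: "'x info \<Rightarrow> 'u \<Rightarrow> real"

text \<open>
  Finite-dimensional in the parametric sense: measurably parametrized by a Borel subset of a
  Euclidean space \<open>\<real>\<^sup>d\<close>, here with coordinates indexed by \<open>{..<d}\<close>.  This covers linear families
  such as finite mixtures as well as curved ones such as exponential families.
\<close>

definition finite_dim_family :: "'x measure \<Rightarrow> 'x measure set \<Rightarrow> bool" where
  "finite_dim_family S Z \<longleftrightarrow>
     (\<exists>(d::nat) \<Theta> \<theta>. \<Theta> \<in> sets (\<Pi>\<^sub>M i\<in>{..<d}. (borel :: real measure)) \<and>
        \<theta> \<in> restrict_space (\<Pi>\<^sub>M i\<in>{..<d}. (borel :: real measure)) \<Theta> \<rightarrow>\<^sub>M prob_algebra S \<and>
        \<theta> ` \<Theta> = Z)"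

locale filter_approximation = observation_model M
  for M :: "('x, 'u, 'e, 'v) obs_model" +
  fixes A :: "nat \<Rightarrow> ('x, 'u) filter_approx"
  assumes family_class: "\<And>N k. k \<in> classes M \<Longrightarrow> family (A N) k \<subseteq> class_measures M k"
    and family_finite_dim:
      "\<And>N k. k \<in> classes M \<Longrightarrow> finite_dim_family (states M) (family (A N) k)"
    and proj_dom_prob:
      "\<And>N k. k \<in> classes M \<Longrightarrow> proj_dom (A N) k \<subseteq> space (prob_algebra (states M))"
    and proj_dom_family: "\<And>N k. k \<in> classes M \<Longrightarrow> family (A N) k \<subseteq> proj_dom (A N) k"
    and proj_dom_rho: "\<And>N k. k \<in> classes M \<Longrightarrow> rho M k \<in> proj_dom (A N) k"
    and proj_dom_filter_update:
      "\<And>N k j \<mu> u. k \<in> classes M \<Longrightarrow> (j, \<mu>) \<in> info_states M \<Longrightarrow> u \<in> space (actions M) \<Longrightarrow>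
         obs_prob M k \<mu> u > 0 \<Longrightarrow> filter_update M k \<mu> u \<in> proj_dom (A N) k"
    and proj_measurable:
      "\<And>N k. k \<in> classes M \<Longrightarrow>
         proj (A N) k \<in> restrict_space (prob_algebra (states M)) (proj_dom (A N) k)
           \<rightarrow>\<^sub>M prob_algebra (states M)"
    and proj_into: "\<And>N k. k \<in> classes M \<Longrightarrow> proj (A N) k \<in> proj_dom (A N) k \<rightarrow> family (A N) k"
    and proj_fixes: "\<And>N k z. k \<in> classes M \<Longrightarrow> z \<in> family (A N) k \<Longrightarrow> proj (A N) k z = z"

text \<open>
  Since \<open>filter_update\<close> already takes the value \<open>rho\<close> on events of probability zero, applying
  \<open>proj\<close> to it gives both cases of the approximate filter.
\<close>

definition approx_update ::
  "('x, 'u, 'e, 'v) obs_model \<Rightarrow> ('x, 'u) filter_approx \<Rightarrow> nat \<Rightarrow> 'x measure \<Rightarrow> 'u \<Rightarrow> 'x measure" where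
  "approx_update M a k \<mu> u = proj a k (filter_update M k \<mu> u)"

definition approx_kernel ::
  "('x, 'u, 'e, 'v) obs_model \<Rightarrow> ('x, 'u) filter_approx \<Rightarrow> 'x info \<Rightarrow> 'u \<Rightarrow> 'x info measure" where
  "approx_kernel M a = posterior_kernel M (approx_update M a)"

definition bellman_approx ::
  "('x, 'u, 'e, 'v) obs_model \<Rightarrow> ('x, 'u) filter_approx \<Rightarrow> ('x info \<Rightarrow> real) \<Rightarrow> 'x info \<Rightarrow> real" where
  "bellman_approx M a = bellman M (approx_cost a) (approx_kernel M a)"

definition bounded_borel :: "'a measure \<Rightarrow> ('a \<Rightarrow> real) set" where
  "bounded_borel S = {v \<in> borel_measurable S. bounded (v ` space S)}"

text \<open>
  Closed linear subspaces of the bounded Borel functions under the supremum norm.  Only values on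
  \<open>space S\<close> matter: closure under uniform limits on \<open>space S\<close>, applied to a constant sequence,
  makes \<open>F\<close> invariant under changes off \<open>space S\<close>.
\<close>

definition banach_function_space :: "'a measure \<Rightarrow> ('a \<Rightarrow> real) set \<Rightarrow> bool" where
  "banach_function_space S F \<longleftrightarrow>
     F \<subseteq> bounded_borel S \<and> (\<lambda>_. 0) \<in> F \<and>
     (\<forall>v\<in>F. \<forall>w\<in>F. (\<lambda>x. v x + w x) \<in> F) \<and>
     (\<forall>a. \<forall>v\<in>F. (\<lambda>x. a * v x) \<in> F) \<and>
     (\<forall>f w. (\<forall>n::nat. f n \<in> F) \<and> uniform_limit (space S) f w sequentially \<longrightarrow> w \<in> F)"

lemma bounded_borel_banach: "banach_function_space S (bounded_borel S)"
proof -
  have lim: "w \<in> bounded_borel S" if f: "\<forall>n::nat. f n \<in> bounded_borel S" and u: "uniform_limit (space S) f w sequentially" for f w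
  proof -
    have "w \<in> borel_measurable S"
    proof (rule borel_measurable_LIMSEQ_real)
      show "f n \<in> borel_measurable S" for n using f by (simp add: bounded_borel_def)
      show "(\<lambda>n. f n x) \<longlonglongrightarrow> w x" if "x \<in> space S" for x by (rule tendsto_uniform_limitI[OF u that])
    qed
    moreover have "bounded (w ` space S)"
    proof -
      from uniform_limitD[OF u, of 1] obtain n where n: "\<forall>x\<in>space S. dist (f n x) (w x) < 1"
        unfolding eventually_sequentially by (metis order_refl zero_less_one)
      have "bounded (f n ` space S)" using f by (simp add: bounded_borel_def)
      then obtain b where b: "\<forall>x\<in>space S. \<bar>f n x\<bar> \<le> b" by (auto simp: bounded_iff)
      have "\<bar>w x\<bar> \<le> b + 1" if "x \<in> space S" for x
        using n[rule_format, OF that] b[rule_format, OF that] unfolding dist_real_def by linarith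
      then show ?thesis unfolding bounded_iff by auto
    qed
    ultimately show ?thesis unfolding bounded_borel_def by simp
  qed
  have add: "bounded ((\<lambda>x. v x + w x) ` space S)" if "bounded (v ` space S)" "bounded (w ` space S)" for v w :: "_ \<Rightarrow> real"
    using that by (rule bounded_plus_comp)
  have scale: "bounded ((\<lambda>x. a * v x) ` space S)" if "bounded (v ` space S)" for v :: "_ \<Rightarrow> real" and a
    using bounded_scaling[OF that, of a] by (simp add: image_image)
  show ?thesis unfolding banach_function_space_def
  proof (intro conjI ballI allI impI)
    fix v w f and a :: real
    show "(\<lambda>x. v x + w x) \<in> bounded_borel S" if "v \<in> bounded_borel S" "w \<in> bounded_borel S"
      using that add[of v w] borel_measurable_add[of v S w] unfolding bounded_borel_def by simp
    show "(\<lambda>x. a * v x) \<in> bounded_borel S" if "v \<in> bounded_borel S"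
      using that scale[of v a] borel_measurable_times[of "\<lambda>_. a" S v] unfolding bounded_borel_def by simp
    show "w \<in> bounded_borel S"
      if "(\<forall>n::nat. f n \<in> bounded_borel S) \<and> uniform_limit (space S) f w sequentially"
      using that lim by blast
    show "(\<lambda>_. 0) \<in> bounded_borel S" unfolding bounded_borel_def by (simp add: image_constant_conv)
  qed simp
qed

text \<open>Error suprema are extended real, since an approximate cost need not be bounded.\<close>

definition sup_dist :: "'a set \<Rightarrow> ('a \<Rightarrow> real) \<Rightarrow> ('a \<Rightarrow> real) \<Rightarrow> ereal" where
  "sup_dist R f g = (SUP I\<in>R. ereal \<bar>f I - g I\<bar>)"

definition contraction_wrt ::
  "'a set \<Rightarrow> real \<Rightarrow> ('a \<Rightarrow> real) set \<Rightarrow> (('a \<Rightarrow> real) \<Rightarrow> 'a \<Rightarrow> real) \<Rightarrow> bool" where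
  "contraction_wrt R c F T \<longleftrightarrow>
     T \<in> F \<rightarrow> F \<and> (\<forall>v\<in>F. \<forall>w\<in>F. sup_dist R (T v) (T w) \<le> ereal c * sup_dist R v w)"

definition fixed_point_in ::
  "'a measure \<Rightarrow> ('a \<Rightarrow> real) set \<Rightarrow> (('a \<Rightarrow> real) \<Rightarrow> 'a \<Rightarrow> real) \<Rightarrow> ('a \<Rightarrow> real) \<Rightarrow> bool" where
  "fixed_point_in S F T v \<longleftrightarrow> v \<in> F \<and> (\<forall>I\<in>space S. T v I = v I)"

definition bellman_error ::
  "('x, 'u, 'e, 'v) obs_model \<Rightarrow> ('x, 'u) filter_approx \<Rightarrow> ('x info \<Rightarrow> real) \<Rightarrow> ereal" where
  "bellman_error M a v = sup_dist (reachable M) (bellman_approx M a v) (bellman_exact M v)"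

definition kernel_error ::
  "('x, 'u, 'e, 'v) obs_model \<Rightarrow> ('x, 'u) filter_approx \<Rightarrow> ('x info \<Rightarrow> real) \<Rightarrow> ereal" where
  "kernel_error M a v =
     (SUP (I, u)\<in>reachable M \<times> space (actions M).
        ereal \<bar>(\<integral>I'. v I' \<partial>approx_kernel M a I u) - (\<integral>I'. v I' \<partial>info_kernel M I u)\<bar>)"

definition cost_error ::
  "('x, 'u, 'e, 'v) obs_model \<Rightarrow> ('x, 'u) filter_approx \<Rightarrow> ereal" where
  "cost_error M a =
     (SUP (I, u)\<in>reachable M \<times> space (actions M). ereal \<bar>approx_cost a I u - info_cost M I u\<bar>)"

end

theory Submission
  imports Defs
begin

text \<open>
  Write \<open>R\<close> for the set of reachable information states and \<open>D\<close> for the distance of \<open>VN\<close> and \<open>V\<close>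
  over \<open>R\<close>.  On \<open>R\<close> the fixed-point equations turn \<open>VN - V\<close> into \<open>(B\<^sub>N VN - B\<^sub>N V) + (B\<^sub>N V - B V)\<close>.
  The first difference is at most \<open>\<alpha> D\<close> if \<open>B\<^sub>N\<close> contracts over \<open>R\<close>, and the second is at
  most the Bellman error \<open>\<beta>\<close>.  Hence \<open>D \<le> \<alpha> D + \<beta>\<close>.  Both functions are bounded, so \<open>D < \<infinity>\<close>
  and this can be solved for \<open>D\<close> (\<open>sup_dist_fixed_points_le\<close>).  A contraction over the whole
  information space would bound the first difference only by \<open>\<alpha>\<close> times the distance over that
  space: approximate posteriors may leave \<open>R\<close>, so \<open>B\<^sub>N v\<close> on \<open>R\<close> may depend on \<open>v\<close> off \<open>R\<close>.

  The bound on \<open>\<beta>\<close> holds because taking an infimum is nonexpansive: two infima over the same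
  actions differ by at most the largest difference of the two objectives (\<open>abs_INF_diff_le\<close>), and
  that difference splits into a cost part and \<open>\<alpha>\<close> times a kernel part.  Infima of reals behave like
  this only if both families are bounded below.  For the exact operator this follows from the bounded
  cost, and for both operators the integral of a bounded function over the next information state is
  bounded uniformly in the action (\<open>abs_integral_posterior_kernel_le\<close>).  These bounds are available
  on information states, so \<open>R\<close> must be shown to consist of such
  (\<open>reachable_subset_info_states\<close>).
\<close>

section \<open>Suprema, infima and fixed points\<close>

lemma abs_INF_diff_le:
  fixes f g :: "'a \<Rightarrow> real"
  assumes "A \<noteq> {}" and "bdd_below (f ` A)" and "bdd_below (g ` A)"
    and close: "\<And>x. x \<in> A \<Longrightarrow> \<bar>f x - g x\<bar> \<le> e"
  shows "\<bar>(INF x\<in>A. f x) - (INF x\<in>A. g x)\<bar> \<le> e"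
proof -
  have half: "(INF x\<in>A. h x) - e \<le> (INF x\<in>A. k x)"
    if "bdd_below (h ` A)" "\<And>x. x \<in> A \<Longrightarrow> \<bar>h x - k x\<bar> \<le> e" for h k :: "'a \<Rightarrow> real"
  proof (rule cINF_greatest[OF \<open>A \<noteq> {}\<close>])
    fix x assume x: "x \<in> A"
    show "(INF x\<in>A. h x) - e \<le> k x"
      using cINF_lower[OF that(1) x] that(2)[OF x] by linarith
  qed
  show ?thesis
    using half[of f g] half[of g f] assms by (simp add: abs_minus_commute abs_le_iff)
qed

lemma sup_dist_le_iff: "sup_dist R f g \<le> e \<longleftrightarrow> (\<forall>I\<in>R. ereal \<bar>f I - g I\<bar> \<le> e)"
  by (simp add: sup_dist_def SUP_le_iff)

lemma sup_dist_less_top: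
  assumes "bounded (f ` R)" and "bounded (g ` R)"
  shows "sup_dist R f g < \<infinity>"
proof -
  obtain a b where ab: "\<forall>I\<in>R. \<bar>f I\<bar> \<le> a" "\<forall>I\<in>R. \<bar>g I\<bar> \<le> b"
    using assms by (auto simp: bounded_iff)
  have "\<bar>f I - g I\<bar> \<le> a + b" if "I \<in> R" for I
    using ab[rule_format, OF that] by linarith
  then have "sup_dist R f g \<le> ereal (a + b)"
    by (simp add: sup_dist_le_iff)
  then show ?thesis
    by (rule le_less_trans) simp
qed

text \<open>
  Subtracting \<open>c * d\<close> needs \<open>d < \<infinity>\<close>.  The value \<open>- \<infinity>\<close> of either variable does occur: it is
  the supremum over the empty set.
\<close>

lemma ereal_le_divide_of_le_contraction:
  fixes d b :: ereal and c :: real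
  assumes "d < \<infinity>" and "c < 1" and "d \<le> ereal c * d + b"
  shows "d \<le> b / ereal (1 - c)"
proof (cases d)
  case (real r)
  show ?thesis
  proof (cases b)
    case (real s)
    have "(1 - c) * r \<le> s"
      using assms(3) \<open>d = ereal r\<close> real by (simp add: algebra_simps)
    then have "r \<le> s / (1 - c)"
      using \<open>c < 1\<close> by (simp add: pos_le_divide_eq mult.commute)
    then show ?thesis
      using \<open>d = ereal r\<close> real \<open>c < 1\<close> by simp
  qed (use assms real in auto)
qed (use assms in auto)

text \<open>
  The set \<open>R\<close> over which the error is measured may be smaller than the space on which the fixed-point
  equations hold, provided that one of the operators, here \<open>T'\<close>, contracts the distance over \<open>R\<close>.
\<close>

lemma sup_dist_fixed_points_le:
  assumes v: "fixed_point_in S F T v" and v': "fixed_point_in S F T' v'"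
    and "F \<subseteq> bounded_borel S" and R: "R \<subseteq> space S" and "c < 1"
    and contr: "contraction_wrt R c F T'"
  shows "sup_dist R v' v \<le> sup_dist R (T' v) (T v) / ereal (1 - c)"
proof (rule ereal_le_divide_of_le_contraction)
  have F: "v \<in> F" "v' \<in> F"
    using v v' by (auto simp: fixed_point_in_def)
  have "bounded (w ` R)" if "w \<in> F" for w
    using that \<open>F \<subseteq> bounded_borel S\<close> R unfolding bounded_borel_def
    by (blast intro: bounded_subset)
  then show "sup_dist R v' v < \<infinity>"
    using F by (intro sup_dist_less_top)
  have contr': "sup_dist R (T' v') (T' v) \<le> ereal c * sup_dist R v' v"
    using contr F by (auto simp: contraction_wrt_def)
  show "sup_dist R v' v \<le> ereal c * sup_dist R v' v + sup_dist R (T' v) (T v)"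
    unfolding sup_dist_le_iff[of R v']
  proof
    fix I assume I: "I \<in> R"
    have "T' v' I = v' I" "T v I = v I"
      using v v' I R by (auto simp: fixed_point_in_def)
    then have "ereal \<bar>v' I - v I\<bar> \<le> ereal \<bar>T' v' I - T' v I\<bar> + ereal \<bar>T' v I - T v I\<bar>"
      by simp
    also have "\<dots> \<le> ereal c * sup_dist R v' v + sup_dist R (T' v) (T v)"
    proof (rule add_mono)
      show "ereal \<bar>T' v' I - T' v I\<bar> \<le> ereal c * sup_dist R v' v"
        using contr' I unfolding sup_dist_le_iff by blast
      show "ereal \<bar>T' v I - T v I\<bar> \<le> sup_dist R (T' v) (T v)"
        unfolding sup_dist_def using I by (rule SUP_upper)
    qed
    finally show "ereal \<bar>v' I - v I\<bar> \<le> ereal c * sup_dist R v' v + sup_dist R (T' v) (T v)" .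
  qed
qed fact

section \<open>Integrals of bounded functions\<close>

text \<open>
  For integrable \<open>f\<close> this is monotonicity; otherwise the integral is \<open>0\<close> by convention, which is
  where \<open>0 \<le> b\<close> enters.
\<close>

lemma (in finite_measure) abs_integral_le_bound:
  fixes f :: "'a \<Rightarrow> real"
  assumes "0 \<le> b" and "\<And>x. x \<in> space M \<Longrightarrow> \<bar>f x\<bar> \<le> b"
  shows "\<bar>\<integral>x. f x \<partial>M\<bar> \<le> b * measure M (space M)"
proof (cases "integrable M f")
  case True
  have "\<bar>\<integral>x. f x \<partial>M\<bar> \<le> (\<integral>x. \<bar>f x\<bar> \<partial>M)"
    by (rule integral_abs_bound)
  also have "\<dots> \<le> (\<integral>x. b \<partial>M)"
    using True assms by (intro integral_mono) auto
  also have "\<dots> = b * measure M (space M)"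
    by (simp add: mult.commute)
  finally show ?thesis .
qed (use assms in \<open>simp add: not_integrable_integral_eq\<close>)

section \<open>The filter\<close>

context observation_model
begin

lemma trans_kernel_measurable:
  assumes u: "u \<in> space (actions M)"
  shows "(\<lambda>x. trans_kernel M x u) \<in> states M \<rightarrow>\<^sub>M prob_algebra (states M)"
  unfolding trans_kernel_def
proof (rule measurable_distr_prob_space2)
  show "(\<lambda>_. noise_eta M \<Otimes>\<^sub>M noise_eps M) \<in> states M \<rightarrow>\<^sub>M prob_algebra (noise_eta M \<Otimes>\<^sub>M noise_eps M)"
    using prob_space_pair[OF noise_eta_prob noise_eps_prob]
    by (intro measurable_const) (simp add: space_prob_algebra)
  have "(\<lambda>p. (fst p, u, fst (snd p), snd (snd p)))
      \<in> states M \<Otimes>\<^sub>M noise_eta M \<Otimes>\<^sub>M noise_eps M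
        \<rightarrow>\<^sub>M states M \<Otimes>\<^sub>M actions M \<Otimes>\<^sub>M noise_eta M \<Otimes>\<^sub>M noise_eps M"
    using u by measurable
  from measurable_compose[OF this dyn_measurable]
  show "(\<lambda>(x, (e, v)). dyn M (x, u, e, v))
      \<in> states M \<Otimes>\<^sub>M noise_eta M \<Otimes>\<^sub>M noise_eps M \<rightarrow>\<^sub>M states M"
    by (simp add: case_prod_unfold)
qed

lemma prediction_in_prob_algebra:
  assumes "\<mu> \<in> space (prob_algebra (states M))" and "u \<in> space (actions M)"
  shows "prediction M u \<mu> \<in> space (prob_algebra (states M))"
  unfolding prediction_def space_prob_algebra
  using assms prob_space_bind' sets_bind' trans_kernel_measurable by blast

lemma obs_prob_le_1:
  assumes "\<mu> \<in> space (prob_algebra (states M))" and "u \<in> space (actions M)"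
  shows "obs_prob M k \<mu> u \<le> 1"
  using prediction_in_prob_algebra[OF assms] prob_space.prob_le_1
  by (auto simp: obs_prob_def space_prob_algebra)

lemma uniform_measure_in_class_measures:
  assumes \<mu>: "\<mu> \<in> space (prob_algebra (states M))" and k: "k \<in> classes M"
    and pos: "measure \<mu> (obs M k) > 0"
  shows "uniform_measure \<mu> (obs M k) \<in> class_measures M k"
proof -
  interpret \<mu>: prob_space \<mu>
    using \<mu> by (simp add: space_prob_algebra)
  have sets: "sets \<mu> = sets (states M)"
    using \<mu> by (simp add: space_prob_algebra)
  have O: "obs M k \<in> sets \<mu>"
    using obs_sets k sets by (auto simp: classes_def)
  have "emeasure \<mu> (obs M k) \<noteq> 0"
    using pos by (simp add: \<mu>.emeasure_eq_measure)
  then have "prob_space (uniform_measure \<mu> (obs M k))"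
    by (intro prob_space_uniform_measure) auto
  moreover have "measure (uniform_measure \<mu> (obs M k)) (obs M k) = 1"
    using O pos by (simp add: \<mu>.emeasure_eq_measure)
  ultimately show ?thesis
    using sets by (simp add: class_measures_def space_prob_algebra)
qed

lemma reachable_subset_info_states: "reachable M \<subseteq> info_states M"
proof (rule subrelI)
  fix j \<mu> assume "(j, \<mu>) \<in> reachable M"
  then show "(j, \<mu>) \<in> info_states M"
  proof induction
    case (start k)
    then show ?case
      using uniform_measure_in_class_measures init_prob by (simp add: info_states_def)
  next
    case (step j \<mu> u k)
    then have "prediction M u \<mu> \<in> space (prob_algebra (states M))"
      by (intro prediction_in_prob_algebra) (auto simp: info_states_def class_measures_def)
    with step show ?case
      using uniform_measure_in_class_measures
      by (simp add: info_states_def filter_update_def obs_prob_def)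
  qed
qed

lemma space_info_space: "space (info_space M) = info_states M"
  by (auto simp: info_space_def space_restrict_space space_pair_measure info_states_def
      class_measures_def)

section \<open>Boundedness of the Bellman objectives\<close>

text \<open>
  The defining set function gives the whole space at most the sum of the observation probabilities,
  each at most \<open>1\<close>.  The bound does not depend on the posterior map, so it serves the exact and the
  approximate kernel alike; that it is uniform in \<open>u\<close> is what matters.
\<close>

lemma abs_integral_posterior_kernel_le:
  assumes I: "I \<in> info_states M" and u: "u \<in> space (actions M)"
    and "0 \<le> b" and b: "\<And>I'. I' \<in> info_states M \<Longrightarrow> \<bar>v I'\<bar> \<le> b"
  shows "\<bar>\<integral>I'. v I' \<partial>posterior_kernel M \<phi> I u\<bar> \<le> b * real (card (classes M))"
proof -
  let ?K = "posterior_kernel M \<phi> I u"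
  have space: "space ?K = info_states M"
    by (simp add: posterior_kernel_def space_measure_of_conv space_info_space)
  have \<mu>: "snd I \<in> space (prob_algebra (states M))"
    using I by (auto simp: info_states_def class_measures_def)
  \<comment> \<open>\<open>measure_of\<close> has either the given values or the value \<open>0\<close> throughout, so this upper bound
    holds without checking that the set function is countably additive.\<close>
  have "emeasure ?K (space ?K)
      \<le> (\<Sum>k\<in>classes M. ennreal (obs_prob M k (snd I) u)
          * indicator (space ?K) (k, \<phi> k (snd I) u))"
    by (simp add: posterior_kernel_def emeasure_measure_of_conv)
  also have "\<dots> \<le> (\<Sum>k\<in>classes M. 1)"
    using obs_prob_le_1[OF \<mu> u]
    by (intro sum_mono) (auto simp: indicator_def)
  also have "\<dots> = ennreal (real (card (classes M)))"
    by (simp add: ennreal_of_nat_eq_real_of_nat)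
  finally have total: "emeasure ?K (space ?K) \<le> ennreal (real (card (classes M)))" .
  then interpret K: finite_measure ?K
    by (intro finite_measureI) (auto simp: top_unique)
  have "\<bar>\<integral>I'. v I' \<partial>?K\<bar> \<le> b * measure ?K (space ?K)"
    using assms(3) b space by (intro K.abs_integral_le_bound) auto
  also have "\<dots> \<le> b * real (card (classes M))"
    using total \<open>0 \<le> b\<close> by (intro mult_left_mono) (auto simp: K.emeasure_eq_measure)
  finally show ?thesis .
qed

lemma bdd_below_info_cost:
  assumes I: "I \<in> info_states M"
  shows "bdd_below (info_cost M I ` space (actions M))"
proof -
  obtain b where b: "\<forall>p\<in>space (states M) \<times> space (actions M). \<bar>cost M p\<bar> \<le> b"
    using cost_bounded by (auto simp: bounded_iff)
  interpret \<mu>: prob_space "snd I"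
    using I by (auto simp: info_states_def class_measures_def space_prob_algebra)
  have space: "space (snd I) = space (states M)"
    using I by (intro sets_eq_imp_space_eq)
      (auto simp: info_states_def class_measures_def space_prob_algebra)
  have "- \<bar>b\<bar> \<le> info_cost M I u" if u: "u \<in> space (actions M)" for u
  proof -
    have "\<bar>cost M (x, u)\<bar> \<le> \<bar>b\<bar>" if "x \<in> space (snd I)" for x
      using b that u space by force
    then have "\<bar>info_cost M I u\<bar> \<le> \<bar>b\<bar>"
      using \<mu>.abs_integral_le_bound[of "\<bar>b\<bar>" "\<lambda>x. cost M (x, u)"]
      by (simp add: info_cost_def \<mu>.prob_space)
    then show ?thesis by linarith
  qed
  then show ?thesis
    by (rule bdd_belowI2)
qed

lemma bdd_below_bellman_objective:
  assumes I: "I \<in> info_states M" and v: "bounded (v ` info_states M)"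
    and h: "bdd_below (h I ` space (actions M))"
  shows "bdd_below ((\<lambda>u. h I u + discount M * (\<integral>I'. v I' \<partial>posterior_kernel M \<phi> I u))
           ` space (actions M))"
proof -
  obtain m where m: "\<And>u. u \<in> space (actions M) \<Longrightarrow> m \<le> h I u"
    using h by (auto simp: bdd_below_def)
  obtain b where b: "0 < b" "\<And>I'. I' \<in> info_states M \<Longrightarrow> \<bar>v I'\<bar> \<le> b"
    using v by (auto simp: bounded_pos)
  let ?c = "b * real (card (classes M))"
  have "m + discount M * - ?c
      \<le> h I u + discount M * (\<integral>I'. v I' \<partial>posterior_kernel M \<phi> I u)"
    if u: "u \<in> space (actions M)" for u
  proof (intro add_mono mult_left_mono)
    have "\<bar>\<integral>I'. v I' \<partial>posterior_kernel M \<phi> I u\<bar> \<le> ?c"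
      by (rule abs_integral_posterior_kernel_le[OF I u less_imp_le[OF b(1)] b(2)])
    then show "- ?c \<le> (\<integral>I'. v I' \<partial>posterior_kernel M \<phi> I u)"
      by linarith
  qed (use m[OF u] discount_pos in auto)
  then show ?thesis
    by (rule bdd_belowI2)
qed

section \<open>The Bellman error\<close>

text \<open>
  The estimate is pointwise in the information state.  If the right-hand side is \<open>\<infinity>\<close> there is
  nothing to show.  It is not \<open>- \<infinity>\<close>, because some action exists and the right-hand side bounds the
  difference of the objectives there.  If it is a real number, it bounds that difference for every
  action and hence the difference of the infima.
\<close>

lemma bellman_error_le:
  assumes v: "bounded (v ` info_states M)"
    and h: "\<And>I. I \<in> info_states M \<Longrightarrow> bdd_below (approx_cost a I ` space (actions M))"
  shows "bellman_error M a v \<le> cost_error M a + ereal (discount M) * kernel_error M a v"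
    (is "_ \<le> ?E")
  unfolding bellman_error_def sup_dist_le_iff
proof
  fix I assume IR: "I \<in> reachable M"
  then have I: "I \<in> info_states M"
    using reachable_subset_info_states by blast
  let ?p = "\<lambda>u. approx_cost a I u + discount M * (\<integral>I'. v I' \<partial>approx_kernel M a I u)"
  let ?q = "\<lambda>u. info_cost M I u + discount M * (\<integral>I'. v I' \<partial>info_kernel M I u)"
  have close: "ereal \<bar>?p u - ?q u\<bar> \<le> ?E" if u: "u \<in> space (actions M)" for u
  proof -
    let ?g = "\<bar>approx_cost a I u - info_cost M I u\<bar>"
    let ?k = "\<bar>(\<integral>I'. v I' \<partial>approx_kernel M a I u) - (\<integral>I'. v I' \<partial>info_kernel M I u)\<bar>"
    have "?p u - ?q u = (approx_cost a I u - info_cost M I u) + discount M *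
        ((\<integral>I'. v I' \<partial>approx_kernel M a I u) - (\<integral>I'. v I' \<partial>info_kernel M I u))"
      by (simp add: algebra_simps)
    also have "\<bar>\<dots>\<bar> \<le> ?g + discount M * ?k"
      using discount_pos by (intro order_trans[OF abs_triangle_ineq]) (simp add: abs_mult)
    finally have "\<bar>?p u - ?q u\<bar> \<le> ?g + discount M * ?k" .
    then have "ereal \<bar>?p u - ?q u\<bar> \<le> ereal ?g + ereal (discount M) * ereal ?k"
      by simp
    also have "\<dots> \<le> ?E"
    proof (intro add_mono ereal_mult_left_mono)
      show "ereal ?g \<le> cost_error M a"
        unfolding cost_error_def using IR u by (intro SUP_upper2[of "(I, u)"]) auto
      show "ereal ?k \<le> kernel_error M a v"
        unfolding kernel_error_def using IR u by (intro SUP_upper2[of "(I, u)"]) auto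
    qed (use discount_pos in simp)
    finally show ?thesis .
  qed
  have bdd: "bdd_below (?p ` space (actions M))" "bdd_below (?q ` space (actions M))"
    unfolding approx_kernel_def info_kernel_def
    by (intro bdd_below_bellman_objective I v h bdd_below_info_cost)+
  show "ereal \<bar>bellman_approx M a v I - bellman_exact M v I\<bar> \<le> ?E"
  proof (cases ?E)
    case (real e)
    then show ?thesis
      using abs_INF_diff_le[OF actions_nonempty bdd, of e] close
      by (simp add: bellman_approx_def bellman_exact_def bellman_def)
  next
    case MInf
    obtain u where "u \<in> space (actions M)"
      using actions_nonempty by blast
    from close[OF this] show ?thesis
      unfolding MInf by simp
  next
    case PInf
    show ?thesis
      unfolding PInf by simp
  qed
qed

end

section \<open>Error of the approximate value function\<close>

theorem theorem8:
  fixes M :: "('x, 'u, 'e, 'v) obs_model"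
    and A :: "nat \<Rightarrow> ('x, 'u) filter_approx"
    and N :: nat
    and F :: "('x info \<Rightarrow> real) set"
    and V VN :: "'x info \<Rightarrow> real"
  assumes "filter_approximation M A"
    and "\<And>I. I \<in> space (info_space M) \<Longrightarrow>
           bdd_below (approx_cost (A N) I ` space (actions M))"
    and "banach_function_space (info_space M) F"
    and "contraction_wrt (space (info_space M)) (discount M) F (bellman_exact M)"
    and "contraction_wrt (space (info_space M)) (discount M) F (bellman_approx M (A N))"
    and "fixed_point_in (info_space M) F (bellman_exact M) V"
    and "fixed_point_in (info_space M) F (bellman_approx M (A N)) VN"
  shows "bellman_error M (A N) V \<le> cost_error M (A N) + discount M * kernel_error M (A N) V \<and>
    (contraction_wrt (reachable M) (discount M) F (bellman_approx M (A N)) \<longrightarrow>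
      (\<forall>\<epsilon>::real. bellman_error M (A N) V \<le> \<epsilon> \<longrightarrow>
         sup_dist (reachable M) VN V \<le> \<epsilon> / (1 - discount M)) \<and>
      sup_dist (reachable M) VN V
        \<le> (cost_error M (A N) + discount M * kernel_error M (A N) V) / (1 - discount M))"
proof -
  interpret filter_approximation M A by fact
  have F: "F \<subseteq> bounded_borel (info_space M)"
    using assms(3) by (simp add: banach_function_space_def)
  have "bounded (V ` info_states M)"
    using assms(6) F by (auto simp: fixed_point_in_def bounded_borel_def space_info_space)
  then have error: "bellman_error M (A N) V
      \<le> cost_error M (A N) + discount M * kernel_error M (A N) V" (is "_ \<le> ?E")
    using assms(2) by (intro bellman_error_le) (simp_all add: space_info_space)
  have fixed: "sup_dist (reachable M) VN V \<le> e / ereal (1 - discount M)"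
    if contr: "contraction_wrt (reachable M) (discount M) F (bellman_approx M (A N))"
      and e: "bellman_error M (A N) V \<le> e" for e
  proof -
    have "sup_dist (reachable M) VN V \<le> bellman_error M (A N) V / ereal (1 - discount M)"
      unfolding bellman_error_def
      using reachable_subset_info_states discount_less_1 contr
      by (intro sup_dist_fixed_points_le[OF assms(6,7) F]) (simp_all add: space_info_space)
    also have "\<dots> \<le> e / ereal (1 - discount M)"
      using e discount_less_1 by (intro ereal_divide_right_mono) simp_all
    finally show ?thesis .
  qed
  show ?thesis
  proof (intro conjI impI allI error fixed)
    fix \<epsilon> :: real
    assume "contraction_wrt (reachable M) (discount M) F (bellman_approx M (A N))"
      and "bellman_error M (A N) V \<le> \<epsilon>"
    from fixed[OF this] show "sup_dist (reachable M) VN V \<le> \<epsilon> / (1 - discount M)"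
      using discount_less_1 by simp
  qed
qed

end
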